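(* The following are equivalent for any ordered magma $M$. (1) $M$ is a precoherent near prequantale. (2) $M$ is isomorphic to the ideal completion $\mathsf{Idl}(N)$ under $\downarrow$-multiplication of some multiplicative semilattice $N$. (3) $\mathsf{K}(M)$ is a sub multiplicative semilattice of $M$ and $M$ is isomorphic to the ordered magma $\mathsf{Idl}(\mathsf{K}(M))$ under $\downarrow$-multiplication. (4) $M$ is isomorphic to $(2^N \setminus\{\emptyset\})^\star$ for some multiplicative semilattice $N$ and some finitary nucleus $\star$ on $2^N \setminus\{\emptyset\}$.
   Context: An ordered magma is a set with a binary operation (written multiplicatively) and a partial order such that $x\le x'$, $y \le y'$ imply $xy \le x'y'$; isomorphisms are order isomorphisms that are magma homomorphisms. A near prequantale is an ordered magma $Q$ such that $\bigvee X$ exists and $a(\bigvee X) = \bigvee(aX)$, $(\bigvee X)a = \bigvee(Xa)$ for every $a \in Q$ and every nonempty $X\subseteq Q$. A multiplicative semilattice is an ordered magma that is a join semilattice with $a(x\vee y) = ax \vee ay$ and $(x\vee y)a = xa\vee ya$ for all $a,x,y$. "$\mathsf{K}(M)$ is a sub multiplicative semilattice of $M$" means that $\mathsf{K}(M)$ is closed under multiplication in $M$, that any two elements of $\mathsf{K}(M)$ have a supremum in $M$ lying in $\mathsf{K}(M)$, and that $\mathsf{K}(M)$ with the induced structure is a multiplicative semilattice. A directed subset of a poset is a nonempty subset $\Delta$ in which every finite subset has an upper bound in $\Delta$. An element $x$ of a poset $S$ is compact if, whenever $x \le \bigvee\Delta$ for a directed $\Delta\subseteq S$ for which $\bigvee\Delta$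 exists, one has $x \le y$ for some $y \in \Delta$; $\mathsf{K}(S)$ is the set of compact elements of $S$. An ordered magma $M$ is precoherent if every element is the supremum of a set of compact elements and $\mathsf{K}(M)$ is closed under multiplication. An ideal of a poset $S$ is a directed downward closed subset; $\mathsf{Idl}(S)$ is the set of ideals ordered by inclusion. For a join semilattice $S$ and nonempty $X\subseteq S$, $\downarrow\! X = \{y\in S: y\le \bigvee T \text{ for some finite nonempty } T\subseteq X\}$; $\downarrow$-multiplication on $\mathsf{Idl}(N)$ is $(I,J)\mapsto\ \downarrow\!(IJ)$, where $IJ=\{xy: x\in I,y\in J\}$. $2^N\setminus\{\emptyset\}$ is the set of nonempty subsets of $N$, ordered by inclusion, with multiplication $(X,Y)\mapsto XY$. A closure operation is an expansive, order-preserving, idempotent self-map; a nucleus on an ordered magma $P$ is a closure operation $\star$ with $x^\star y^\star\le (xy)^\star$; its image $P^\star$ is an ordered magma under the induced order and $(x,y)\mapsto (xy)^\star$. A closure operation $\star$ is finitary if $(\bigvee\Delta)^\star=\bigvee(\Delta^\star)$ for all directed $\Delta$ for which $\bigvee\Delta$ exists. *)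

theory Defs
  imports "HOL-Algebra.Lattice"
begin

text \<open>
  All structures are carrier-based and may be empty. Suprema of arbitrary sets are expressed with
  \<open>is_lub\<close>, which includes their existence; the choice-based \<open>\<Squnion>\<close> and \<open>\<squnion>\<close> of the library are used
  only where existence is part of, or follows from, the surrounding hypotheses.
\<close>

record 'a omagma = "'a gorder" +
  omult :: "['a, 'a] \<Rightarrow> 'a" (infixl \<open>\<cdot>\<index>\<close> 70)

locale ordered_magma = partial_order M for M (structure) +
  assumes omult_closed: "\<lbrakk>x \<in> carrier M; y \<in> carrier M\<rbrakk> \<Longrightarrow> x \<cdot> y \<in> carrier M"
    and omult_mono:
      "\<lbrakk>x \<in> carrier M; x' \<in> carrier M; y \<in> carrier M; y' \<in> carrier M; x \<sqsubseteq> x'; y \<sqsubseteq> y'\<rbrakk>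
        \<Longrightarrow> x \<cdot> y \<sqsubseteq> x' \<cdot> y'"

definition omagma_isomorphic :: "'a omagma \<Rightarrow> 'b omagma \<Rightarrow> bool"
  where "omagma_isomorphic M M' \<longleftrightarrow>
    (\<exists>f. bij_betw f (carrier M) (carrier M') \<and> order_emb M M' f \<and>
      (\<forall>x\<in>carrier M. \<forall>y\<in>carrier M. f (x \<cdot>\<^bsub>M\<^esub> y) = f x \<cdot>\<^bsub>M'\<^esub> f y))"

locale near_prequantale = ordered_magma Q for Q (structure) +
  assumes nonempty_sup_exists: "\<lbrakk>X \<subseteq> carrier Q; X \<noteq> {}\<rbrakk> \<Longrightarrow> \<exists>s. is_lub Q s X"
    and omult_sup_left:
      "\<lbrakk>a \<in> carrier Q; X \<subseteq> carrier Q; X \<noteq> {}\<rbrakk> \<Longrightarrow> a \<cdot> (\<Squnion>X) = \<Squnion>((\<lambda>x. a \<cdot> x) ` X)"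
    and omult_sup_right:
      "\<lbrakk>a \<in> carrier Q; X \<subseteq> carrier Q; X \<noteq> {}\<rbrakk> \<Longrightarrow> (\<Squnion>X) \<cdot> a = \<Squnion>((\<lambda>x. x \<cdot> a) ` X)"

locale multiplicative_semilattice = ordered_magma N + upper_semilattice N for N (structure) +
  assumes omult_join_left:
      "\<lbrakk>a \<in> carrier N; x \<in> carrier N; y \<in> carrier N\<rbrakk> \<Longrightarrow> a \<cdot> (x \<squnion> y) = (a \<cdot> x) \<squnion> (a \<cdot> y)"
    and omult_join_right:
      "\<lbrakk>a \<in> carrier N; x \<in> carrier N; y \<in> carrier N\<rbrakk> \<Longrightarrow> (x \<squnion> y) \<cdot> a = (x \<cdot> a) \<squnion> (y \<cdot> a)"

definition directed_subset :: "('a, 'm) gorder_scheme \<Rightarrow> 'a set \<Rightarrow> bool"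
  where "directed_subset S D \<longleftrightarrow> D \<subseteq> carrier S \<and> D \<noteq> {} \<and>
    (\<forall>F. finite F \<and> F \<subseteq> D \<longrightarrow> (\<exists>u\<in>D. \<forall>x\<in>F. x \<sqsubseteq>\<^bsub>S\<^esub> u))"

definition compact_elements :: "('a, 'm) gorder_scheme \<Rightarrow> 'a set"
  where "compact_elements S = {x \<in> carrier S.
    \<forall>D s. directed_subset S D \<and> is_lub S s D \<and> x \<sqsubseteq>\<^bsub>S\<^esub> s \<longrightarrow> (\<exists>y\<in>D. x \<sqsubseteq>\<^bsub>S\<^esub> y)}"

locale precoherent = ordered_magma M for M (structure) +
  assumes sup_of_compacts: "x \<in> carrier M \<Longrightarrow> \<exists>X. X \<subseteq> compact_elements M \<and> is_lub M x X"
    and compacts_omult_closed: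
      "\<lbrakk>x \<in> compact_elements M; y \<in> compact_elements M\<rbrakk> \<Longrightarrow> x \<cdot> y \<in> compact_elements M"

definition compact_omagma :: "'a omagma \<Rightarrow> 'a omagma"
  where "compact_omagma M = M\<lparr>carrier := compact_elements M\<rparr>"

definition compacts_sub_multiplicative_semilattice :: "'a omagma \<Rightarrow> bool"
  where "compacts_sub_multiplicative_semilattice M \<longleftrightarrow>
    (\<forall>x\<in>compact_elements M. \<forall>y\<in>compact_elements M. x \<cdot>\<^bsub>M\<^esub> y \<in> compact_elements M) \<and>
    (\<forall>x\<in>compact_elements M. \<forall>y\<in>compact_elements M. \<exists>s\<in>compact_elements M. is_lub M s {x, y}) \<and>
    multiplicative_semilattice (compact_omagma M)"

definition order_ideals :: "('a, 'm) gorder_scheme \<Rightarrow> 'a set set"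
  where "order_ideals S = {I. directed_subset S I \<and>
    (\<forall>x\<in>I. \<forall>y\<in>carrier S. y \<sqsubseteq>\<^bsub>S\<^esub> x \<longrightarrow> y \<in> I)}"

definition ideal_generated :: "('a, 'm) gorder_scheme \<Rightarrow> 'a set \<Rightarrow> 'a set"
  where "ideal_generated S X =
    {y \<in> carrier S. \<exists>T. finite T \<and> T \<noteq> {} \<and> T \<subseteq> X \<and> y \<sqsubseteq>\<^bsub>S\<^esub> \<Squnion>\<^bsub>S\<^esub>T}"

definition set_omult :: "'a omagma \<Rightarrow> 'a set \<Rightarrow> 'a set \<Rightarrow> 'a set"
  where "set_omult N X Y = {x \<cdot>\<^bsub>N\<^esub> y | x y. x \<in> X \<and> y \<in> Y}"

definition ideal_completion :: "'a omagma \<Rightarrow> 'a set omagma"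
  where "ideal_completion N =
    \<lparr>carrier = order_ideals N, eq = (=), le = (\<subseteq>),
     omult = (\<lambda>I J. ideal_generated N (set_omult N I J))\<rparr>"

definition nonempty_powerset :: "'a omagma \<Rightarrow> 'a set omagma"
  where "nonempty_powerset N =
    \<lparr>carrier = Pow (carrier N) - {{}}, eq = (=), le = (\<subseteq>), omult = set_omult N\<rparr>"

definition closure_operation :: "('a, 'm) gorder_scheme \<Rightarrow> ('a \<Rightarrow> 'a) \<Rightarrow> bool"
  where "closure_operation P c \<longleftrightarrow> c \<in> carrier P \<rightarrow> carrier P \<and>
    (\<forall>x\<in>carrier P. x \<sqsubseteq>\<^bsub>P\<^esub> c x) \<and> isotone P P c \<and> idempotent P c"

definition nucleus :: "'a omagma \<Rightarrow> ('a \<Rightarrow> 'a) \<Rightarrow> bool"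
  where "nucleus P c \<longleftrightarrow> closure_operation P c \<and>
    (\<forall>x\<in>carrier P. \<forall>y\<in>carrier P. c x \<cdot>\<^bsub>P\<^esub> c y \<sqsubseteq>\<^bsub>P\<^esub> c (x \<cdot>\<^bsub>P\<^esub> y))"

definition finitary :: "('a, 'm) gorder_scheme \<Rightarrow> ('a \<Rightarrow> 'a) \<Rightarrow> bool"
  where "finitary P c \<longleftrightarrow>
    (\<forall>D s. directed_subset P D \<and> is_lub P s D \<longrightarrow> is_lub P (c s) (c ` D))"

definition nucleus_image :: "'a omagma \<Rightarrow> ('a \<Rightarrow> 'a) \<Rightarrow> 'a omagma"
  where "nucleus_image P c =
    P\<lparr>carrier := c ` carrier P, omult := (\<lambda>x y. c (x \<cdot>\<^bsub>P\<^esub> y))\<rparr>"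

end

theory Submission
  imports Defs
begin

text \<open>
  For a multiplicative semilattice \<open>N\<close> the map sending a nonempty set to the ideal it generates is a
  finitary nucleus whose image is exactly the ideal completion of \<open>N\<close>, so (2) is a special case of (4).
  The image of any finitary nucleus \<open>c\<close> on nonempty subsets is a near prequantale, in which directed
  suprema are unions; hence its compact elements are the closures \<open>c F\<close> of finite sets \<open>F\<close>, and these
  are closed under multiplication. Conversely, in a precoherent near prequantale the map sending
  \<open>x\<close> to the set of compact elements below \<open>x\<close> is an isomorphism onto the ideal completion of the
  semilattice of compact elements.
\<close>

text \<open>Finitarity enters through one consequence: a directed union of closed sets is closed, so
  a finite set below a directed supremum lies inside a single member. That the map from
  \<open>M\<close> to ideals respects products rests on a product of two suprema being the supremum
  of all products, obtained by distributing over one factor and then over the other. For directed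
  factors these products form a directed set, so a compact element below the product of the suprema
  is below one product of compact elements. The recurring obstacle is that no least element is
  assumed: the guaranteed suprema are those of nonempty sets, and directed sets and ideals are
  nonempty, so each construction needs its own proof of nonemptiness. Conditions (2) and (4) speak
  of \<open>M\<close> only up to isomorphism, so (1) is transported. This is why suprema are handled
  through the relation \<open>is_lub\<close>, which an isomorphism preserves and reflects, instead
  of the chosen value \<open>\<Squnion>\<close>.\<close>

lemma is_lub_iff:
  assumes "A \<subseteq> carrier L"
  shows "is_lub L s A \<longleftrightarrow> s \<in> carrier L \<and> (\<forall>x\<in>A. x \<sqsubseteq>\<^bsub>L\<^esub> s) \<and>
    (\<forall>u\<in>carrier L. (\<forall>x\<in>A. x \<sqsubseteq>\<^bsub>L\<^esub> u) \<longrightarrow> s \<sqsubseteq>\<^bsub>L\<^esub> u)"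
  using assms unfolding least_def Upper_def by blast

lemma is_lub_le:
  "\<lbrakk>is_lub L s A; u \<in> carrier L; \<And>x. x \<in> A \<Longrightarrow> x \<sqsubseteq>\<^bsub>L\<^esub> u\<rbrakk> \<Longrightarrow> s \<sqsubseteq>\<^bsub>L\<^esub> u"
  by (rule least_le[OF _ Upper_memI])

text \<open>The supremum operator is a Hilbert choice; antisymmetry leaves it only one
  candidate.\<close>

lemma (in partial_order) sup_equality:
  assumes "is_lub L s A"
  shows "\<Squnion>A = s"
  unfolding sup_def using assms by (blast intro: least_unique someI2)

text \<open>The distributivity axioms are equations between chosen suprema. This rule, and
  conversely \<open>is_lub_omult_left\<close> and \<open>is_lub_omult_right\<close>, exchange them
  for statements about \<open>is_lub\<close>, the form that can be transported and computed
  with.\<close>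

lemma near_prequantaleI:
  assumes "ordered_magma Q"
    and sups: "\<And>X. \<lbrakk>X \<subseteq> carrier Q; X \<noteq> {}\<rbrakk> \<Longrightarrow> \<exists>s. is_lub Q s X \<and>
      (\<forall>a\<in>carrier Q. is_lub Q (a \<cdot>\<^bsub>Q\<^esub> s) ((\<lambda>x. a \<cdot>\<^bsub>Q\<^esub> x) ` X) \<and>
        is_lub Q (s \<cdot>\<^bsub>Q\<^esub> a) ((\<lambda>x. x \<cdot>\<^bsub>Q\<^esub> a) ` X))"
  shows "near_prequantale Q"
proof -
  interpret ordered_magma Q by fact
  show ?thesis
  proof
    fix X assume X: "X \<subseteq> carrier Q" "X \<noteq> {}"
    show "\<exists>s. is_lub Q s X"
      using sups[OF X] by blast
    fix a assume a: "a \<in> carrier Q"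
    obtain s where s: "is_lub Q s X" "is_lub Q (a \<cdot>\<^bsub>Q\<^esub> s) ((\<lambda>x. a \<cdot>\<^bsub>Q\<^esub> x) ` X)"
      "is_lub Q (s \<cdot>\<^bsub>Q\<^esub> a) ((\<lambda>x. x \<cdot>\<^bsub>Q\<^esub> a) ` X)"
      using sups[OF X] a by blast
    show "a \<cdot>\<^bsub>Q\<^esub> \<Squnion>\<^bsub>Q\<^esub>X = \<Squnion>\<^bsub>Q\<^esub>((\<lambda>x. a \<cdot>\<^bsub>Q\<^esub> x) ` X)"
      by (simp only: sup_equality[OF s(1)] sup_equality[OF s(2)])
    show "\<Squnion>\<^bsub>Q\<^esub>X \<cdot>\<^bsub>Q\<^esub> a = \<Squnion>\<^bsub>Q\<^esub>((\<lambda>x. x \<cdot>\<^bsub>Q\<^esub> a) ` X)"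
      by (simp only: sup_equality[OF s(1)] sup_equality[OF s(3)])
  qed
qed

context near_prequantale
begin

lemma is_lub_sup: "\<lbrakk>X \<subseteq> carrier Q; X \<noteq> {}\<rbrakk> \<Longrightarrow> is_lub Q (\<Squnion>X) X"
  using nonempty_sup_exists sup_equality by metis

lemma is_lub_omult_left:
  assumes "a \<in> carrier Q" "X \<subseteq> carrier Q" "X \<noteq> {}" "is_lub Q s X"
  shows "is_lub Q (a \<cdot> s) ((\<lambda>x. a \<cdot> x) ` X)"
proof -
  have "is_lub Q (\<Squnion>((\<lambda>x. a \<cdot> x) ` X)) ((\<lambda>x. a \<cdot> x) ` X)"
    using assms by (intro is_lub_sup) (auto intro: omult_closed)
  then show ?thesis
    using omult_sup_left assms sup_equality by metis
qed

lemma is_lub_omult_right: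
  assumes "a \<in> carrier Q" "X \<subseteq> carrier Q" "X \<noteq> {}" "is_lub Q s X"
  shows "is_lub Q (s \<cdot> a) ((\<lambda>x. x \<cdot> a) ` X)"
proof -
  have "is_lub Q (\<Squnion>((\<lambda>x. x \<cdot> a) ` X)) ((\<lambda>x. x \<cdot> a) ` X)"
    using assms by (intro is_lub_sup) (auto intro: omult_closed)
  then show ?thesis
    using omult_sup_right assms sup_equality by metis
qed

end

lemma compact_elements_sub: "compact_elements S \<subseteq> carrier S"
  by (auto simp: compact_elements_def)

section \<open>Transport along isomorphisms\<close>

locale omagma_isomorphism = M: ordered_magma M + M': ordered_magma M'
  for M :: "'a omagma" and M' :: "'b omagma" and f +
  assumes bij: "bij_betw f (carrier M) (carrier M')"
    and emb: "\<lbrakk>x \<in> carrier M; y \<in> carrier M\<rbrakk> \<Longrightarrow> f x \<sqsubseteq>\<^bsub>M'\<^esub> f y \<longleftrightarrow> x \<sqsubseteq>\<^bsub>M\<^esub> y"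
    and hom: "\<lbrakk>x \<in> carrier M; y \<in> carrier M\<rbrakk> \<Longrightarrow> f (x \<cdot>\<^bsub>M\<^esub> y) = f x \<cdot>\<^bsub>M'\<^esub> f y"
begin

lemma carrier_image: "f ` carrier M = carrier M'"
  using bij by (simp add: bij_betw_def)

text \<open>Surjectivity is essential: every competing upper bound in \<open>M'\<close> is the image
  of one in \<open>M\<close>. An order embedding alone need not preserve suprema.\<close>

lemma is_lub_image_iff:
  assumes "X \<subseteq> carrier M" "s \<in> carrier M"
  shows "is_lub M' (f s) (f ` X) \<longleftrightarrow> is_lub M s X"
proof -
  have "f ` X \<subseteq> carrier M'"
    using assms carrier_image by blast
  then show ?thesis
    using assms emb unfolding is_lub_iff[OF assms(1)] is_lub_iff[OF \<open>f ` X \<subseteq> carrier M'\<close>]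
      carrier_image[symmetric] by (auto simp: subset_iff)
qed

lemma directed_image_iff:
  assumes "D \<subseteq> carrier M"
  shows "directed_subset M' (f ` D) \<longleftrightarrow> directed_subset M D"
proof -
  have *: "(\<exists>u\<in>f ` D. \<forall>x\<in>f ` F. x \<sqsubseteq>\<^bsub>M'\<^esub> u) \<longleftrightarrow> (\<exists>u\<in>D. \<forall>x\<in>F. x \<sqsubseteq>\<^bsub>M\<^esub> u)" if "F \<subseteq> D" for F
    using emb assms that by (simp add: subset_iff)
  have "(\<forall>F. finite F \<and> F \<subseteq> f ` D \<longrightarrow> (\<exists>u\<in>f ` D. \<forall>x\<in>F. x \<sqsubseteq>\<^bsub>M'\<^esub> u)) \<longleftrightarrow>
      (\<forall>F. finite F \<and> F \<subseteq> D \<longrightarrow> (\<exists>u\<in>D. \<forall>x\<in>F. x \<sqsubseteq>\<^bsub>M\<^esub> u))"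
    (is "?L \<longleftrightarrow> ?R")
  proof
    assume ?L
    then show ?R
      using * by (metis finite_imageI image_mono)
  next
    assume ?R
    then show ?L
      using * by (metis finite_subset_image)
  qed
  then show ?thesis
    using assms carrier_image unfolding directed_subset_def by (auto simp only: image_is_empty)
qed

lemma compact_image_iff:
  assumes x: "x \<in> carrier M"
  shows "f x \<in> compact_elements M' \<longleftrightarrow> x \<in> compact_elements M"
proof -
  have fx: "f x \<in> carrier M'"
    using x carrier_image by blast
  have "(\<forall>D s. directed_subset M' D \<and> is_lub M' s D \<and> f x \<sqsubseteq>\<^bsub>M'\<^esub> s \<longrightarrow> (\<exists>y\<in>D. f x \<sqsubseteq>\<^bsub>M'\<^esub> y))
    \<longleftrightarrow> (\<forall>D s. directed_subset M D \<and> is_lub M s D \<and> x \<sqsubseteq>\<^bsub>M\<^esub> s \<longrightarrow> (\<exists>y\<in>D. x \<sqsubseteq>\<^bsub>M\<^esub> y))"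
    (is "?L \<longleftrightarrow> ?R")
  proof (intro iffI allI impI; elim conjE)
    fix D s assume L: ?L and D: "directed_subset M D" and s: "is_lub M s D" and xs: "x \<sqsubseteq>\<^bsub>M\<^esub> s"
    have DM: "D \<subseteq> carrier M" and sM: "s \<in> carrier M"
      using D s by (auto simp: directed_subset_def)
    have "\<exists>y\<in>f ` D. f x \<sqsubseteq>\<^bsub>M'\<^esub> y"
      using L D s xs directed_image_iff[OF DM] is_lub_image_iff[OF DM sM] emb[OF x sM] by blast
    then obtain y where "y \<in> D" "f x \<sqsubseteq>\<^bsub>M'\<^esub> f y"
      by auto
    moreover from this have "y \<in> carrier M"
      using DM by auto
    ultimately show "\<exists>y\<in>D. x \<sqsubseteq>\<^bsub>M\<^esub> y"
      using emb[OF x] by auto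
  next
    fix D' s' assume R: ?R and D': "directed_subset M' D'" and s': "is_lub M' s' D'"
      and xs: "f x \<sqsubseteq>\<^bsub>M'\<^esub> s'"
    \<comment> \<open>Compactness of \<open>f x\<close> quantifies over all directed sets of
      \<open>M'\<close>; since \<open>f\<close> is onto, each of them, with its supremum, is the
      image of data in \<open>M\<close>.\<close>
    have "D' \<subseteq> f ` carrier M" "s' \<in> f ` carrier M"
      using D' s' by (auto simp: directed_subset_def carrier_image)
    then obtain D s where DM: "D \<subseteq> carrier M" "D' = f ` D" and sM: "s \<in> carrier M" "s' = f s"
      unfolding subset_image_iff by blast
    have "\<exists>y\<in>D. x \<sqsubseteq>\<^bsub>M\<^esub> y"
      using R D' s' xs directed_image_iff[OF DM(1)] is_lub_image_iff[OF DM(1) sM(1)] emb[OF x sM(1)]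
      unfolding DM(2) sM(2) by blast
    then obtain y where "y \<in> D" "x \<sqsubseteq>\<^bsub>M\<^esub> y"
      by auto
    moreover from this have "y \<in> carrier M"
      using DM by auto
    ultimately show "\<exists>y\<in>D'. f x \<sqsubseteq>\<^bsub>M'\<^esub> y"
      using emb[OF x] DM(2) by (intro bexI[of _ "f y"]) simp_all
  qed
  then show ?thesis
    using x fx by (simp add: compact_elements_def)
qed

lemma precoherent_transport:
  assumes "precoherent M'"
  shows "precoherent M"
proof -
  interpret C: precoherent M' by fact
  show ?thesis
  proof
    fix x assume x: "x \<in> carrier M"
    then have "f x \<in> carrier M'"
      using carrier_image by blast
    then obtain X' where X': "X' \<subseteq> compact_elements M'" "is_lub M' (f x) X'"
      using C.sup_of_compacts[of "f x"] by auto
    have "X' \<subseteq> f ` carrier M"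
      unfolding carrier_image by (rule order_trans[OF X'(1) compact_elements_sub])
    then obtain X where X: "X \<subseteq> carrier M" "X' = f ` X"
      unfolding subset_image_iff by blast
    have "is_lub M x X"
      using X' X x is_lub_image_iff by simp
    moreover have "X \<subseteq> compact_elements M"
      using X X' compact_image_iff by blast
    ultimately show "\<exists>X. X \<subseteq> compact_elements M \<and> is_lub M x X"
      by blast
  next
    fix x y assume xy: "x \<in> compact_elements M" "y \<in> compact_elements M"
    then have "x \<in> carrier M" "y \<in> carrier M"
      by (auto simp: compact_elements_def)
    then show "x \<cdot>\<^bsub>M\<^esub> y \<in> compact_elements M"
      using C.compacts_omult_closed[of "f x" "f y"] xy hom compact_image_iff M.omult_closed
      by metis
  qed
qed

lemma near_prequantale_transport:
  assumes "near_prequantale M'"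
  shows "near_prequantale M"
proof (rule near_prequantaleI)
  interpret Q: near_prequantale M' by fact
  show "ordered_magma M"
    by (rule M.ordered_magma_axioms)
  fix X assume X: "X \<subseteq> carrier M" "X \<noteq> {}"
  then have fX: "f ` X \<subseteq> carrier M'" "f ` X \<noteq> {}"
    using carrier_image by blast+
  obtain s' where "is_lub M' s' (f ` X)"
    using Q.nonempty_sup_exists[OF fX] by blast
  moreover from this have "s' \<in> f ` carrier M"
    unfolding carrier_image by auto
  ultimately obtain s where s: "s \<in> carrier M" "is_lub M' (f s) (f ` X)"
    by blast
  have "is_lub M (a \<cdot>\<^bsub>M\<^esub> s) ((\<lambda>x. a \<cdot>\<^bsub>M\<^esub> x) ` X) \<and> is_lub M (s \<cdot>\<^bsub>M\<^esub> a) ((\<lambda>x. x \<cdot>\<^bsub>M\<^esub> a) ` X)"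
    if a: "a \<in> carrier M" for a
  proof -
    have fa: "f a \<in> carrier M'"
      using a carrier_image by blast
    have eqs: "(\<lambda>x. f a \<cdot>\<^bsub>M'\<^esub> x) ` f ` X = f ` (\<lambda>x. a \<cdot>\<^bsub>M\<^esub> x) ` X"
      "(\<lambda>x. x \<cdot>\<^bsub>M'\<^esub> f a) ` f ` X = f ` (\<lambda>x. x \<cdot>\<^bsub>M\<^esub> a) ` X"
      using hom a X by (auto simp: image_image subset_iff intro!: image_cong)
    have "(\<lambda>x. a \<cdot>\<^bsub>M\<^esub> x) ` X \<subseteq> carrier M" "(\<lambda>x. x \<cdot>\<^bsub>M\<^esub> a) ` X \<subseteq> carrier M"
      "a \<cdot>\<^bsub>M\<^esub> s \<in> carrier M" "s \<cdot>\<^bsub>M\<^esub> a \<in> carrier M"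
      using a s X M.omult_closed by auto
    then show ?thesis
      using Q.is_lub_omult_left[OF fa fX s(2)] Q.is_lub_omult_right[OF fa fX s(2)]
      unfolding eqs hom[OF a s(1), symmetric] hom[OF s(1) a, symmetric]
      by (simp add: is_lub_image_iff)
  qed
  then show "\<exists>s. is_lub M s X \<and> (\<forall>a\<in>carrier M. is_lub M (a \<cdot>\<^bsub>M\<^esub> s) ((\<lambda>x. a \<cdot>\<^bsub>M\<^esub> x) ` X) \<and>
      is_lub M (s \<cdot>\<^bsub>M\<^esub> a) ((\<lambda>x. x \<cdot>\<^bsub>M\<^esub> a) ` X))"
    using s is_lub_image_iff[OF X(1) s(1)] by blast
qed

end

lemma omagma_isomorphic_transport:
  assumes "ordered_magma M" "omagma_isomorphic M M'" "precoherent M'" "near_prequantale M'"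
  shows "precoherent M \<and> near_prequantale M"
proof -
  obtain f where "bij_betw f (carrier M) (carrier M')" "order_emb M M' f"
    "\<forall>x\<in>carrier M. \<forall>y\<in>carrier M. f (x \<cdot>\<^bsub>M\<^esub> y) = f x \<cdot>\<^bsub>M'\<^esub> f y"
    using assms(2) unfolding omagma_isomorphic_def by blast
  then interpret omagma_isomorphism M M' f
    using assms(1) near_prequantale.axioms(1)[OF assms(4)]
    by (simp add: omagma_isomorphism_def omagma_isomorphism_axioms_def order_emb_def)
  show ?thesis
    using assms precoherent_transport near_prequantale_transport by blast
qed

section \<open>Images of finitary nuclei on nonempty powersets\<close>

lemma set_omult_mono: "\<lbrakk>X \<subseteq> X'; Y \<subseteq> Y'\<rbrakk> \<Longrightarrow> set_omult N X Y \<subseteq> set_omult N X' Y'"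
  unfolding set_omult_def by blast

text \<open>As an image of a Cartesian product, the set of products inherits finiteness, and
  finitely many products can be traced back to finitely many pairs of factors.\<close>

lemma set_omult_image: "set_omult N X Y = (\<lambda>(x, y). x \<cdot>\<^bsub>N\<^esub> y) ` (X \<times> Y)"
  unfolding set_omult_def by auto

text \<open>The source of all distributivity in nucleus images: on plain sets, multiplication
  commutes with unions.\<close>

lemma set_omult_UN:
  "set_omult N X (\<Union>\<Y>) = (\<Union>Y\<in>\<Y>. set_omult N X Y)"
  "set_omult N (\<Union>\<Y>) X = (\<Union>Y\<in>\<Y>. set_omult N Y X)"
  unfolding set_omult_def by blast+

lemma nonempty_powerset_is_lub:
  assumes "\<X> \<subseteq> carrier (nonempty_powerset N)" "\<X> \<noteq> {}"
  shows "is_lub (nonempty_powerset N) (\<Union>\<X>) \<X>"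
proof -
  have "\<Union>\<X> \<in> carrier (nonempty_powerset N)"
    using assms by (simp add: nonempty_powerset_def) blast
  then show ?thesis
    unfolding is_lub_iff[OF assms(1)] by (simp add: nonempty_powerset_def Sup_least Union_upper)
qed

lemma nonempty_powerset_is_lub_iff:
  assumes "\<X> \<subseteq> carrier (nonempty_powerset N)" "\<X> \<noteq> {}"
  shows "is_lub (nonempty_powerset N) s \<X> \<longleftrightarrow> s = \<Union>\<X>"
proof
  assume "is_lub (nonempty_powerset N) s \<X>"
  with nonempty_powerset_is_lub[OF assms] show "s = \<Union>\<X>"
    unfolding is_lub_iff[OF assms(1)] by (simp add: nonempty_powerset_def) blast
qed (use nonempty_powerset_is_lub[OF assms] in simp)

locale finitary_nucleus = N: ordered_magma N for N :: "'a omagma" and c +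
  assumes nucleus: "nucleus (nonempty_powerset N) c"
    and finitary: "finitary (nonempty_powerset N) c"
begin

definition nonempty_sub :: "'a set \<Rightarrow> bool"
  where "nonempty_sub X \<longleftrightarrow> X \<subseteq> carrier N \<and> X \<noteq> {}"

abbreviation Q :: "'a set omagma"
  where "Q \<equiv> nucleus_image (nonempty_powerset N) c"

lemma closure_closed: "nonempty_sub X \<Longrightarrow> nonempty_sub (c X)"
  and closure_expansive: "nonempty_sub X \<Longrightarrow> X \<subseteq> c X"
  and closure_mono: "\<lbrakk>nonempty_sub X; nonempty_sub Y; X \<subseteq> Y\<rbrakk> \<Longrightarrow> c X \<subseteq> c Y"
  and closure_idem: "nonempty_sub X \<Longrightarrow> c (c X) = c X"
  and closure_omult: "\<lbrakk>nonempty_sub X; nonempty_sub Y\<rbrakk> \<Longrightarrow>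
    set_omult N (c X) (c Y) \<subseteq> c (set_omult N X Y)"
  using nucleus
  by (auto simp: nucleus_def closure_operation_def nonempty_powerset_def nonempty_sub_def
      isotone_def idempotent_def Pi_iff)

lemma nonempty_sub_omult: "\<lbrakk>nonempty_sub X; nonempty_sub Y\<rbrakk> \<Longrightarrow> nonempty_sub (set_omult N X Y)"
  unfolding nonempty_sub_def set_omult_def using N.omult_closed by blast

lemma nonempty_sub_Union:
  "\<lbrakk>\<X> \<noteq> {}; \<And>X. X \<in> \<X> \<Longrightarrow> nonempty_sub X\<rbrakk> \<Longrightarrow> nonempty_sub (\<Union>\<X>)"
  unfolding nonempty_sub_def by blast

text \<open>Idempotence turns the image of \<open>c\<close> into its set of fixed points, which is
  the description used from here on.\<close>

lemma carrier_iff: "X \<in> carrier Q \<longleftrightarrow> nonempty_sub X \<and> c X = X"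
proof -
  have "Pow (carrier N) - {{}} = {X. nonempty_sub X}"
    by (auto simp: nonempty_sub_def)
  then have carr: "carrier Q = c ` {X. nonempty_sub X}"
    by (simp add: nucleus_image_def nonempty_powerset_def)
  show ?thesis
  proof
    assume "X \<in> carrier Q"
    then obtain Y where "X = c Y" "nonempty_sub Y"
      unfolding carr by blast
    then show "nonempty_sub X \<and> c X = X"
      by (simp add: closure_closed closure_idem)
  next
    assume "nonempty_sub X \<and> c X = X"
    then show "X \<in> carrier Q"
      unfolding carr by (intro image_eqI[of _ _ X]) simp_all
  qed
qed

lemma Q_simps [simp]:
  "(.=\<^bsub>Q\<^esub>) = (=)" "X \<sqsubseteq>\<^bsub>Q\<^esub> Y \<longleftrightarrow> X \<subseteq> Y" "X \<cdot>\<^bsub>Q\<^esub> Y = c (set_omult N X Y)"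
  by (simp_all add: nucleus_image_def nonempty_powerset_def)

lemma closure_in_carrier: "nonempty_sub X \<Longrightarrow> c X \<in> carrier Q"
  by (simp add: carrier_iff closure_closed closure_idem)

text \<open>The Galois connection between \<open>c\<close> and the inclusion of the closed sets; it
  reduces inequalities out of a closure to generators.\<close>

lemma closure_le_iff: "\<lbrakk>nonempty_sub X; Y \<in> carrier Q\<rbrakk> \<Longrightarrow> c X \<subseteq> Y \<longleftrightarrow> X \<subseteq> Y"
  using closure_mono closure_expansive carrier_iff by (metis subset_trans)

text \<open>The nucleus inequality puts the product of closures inside a closed set, and
  expansiveness gives the other inclusion. Thus \<open>c\<close> is multiplicative onto its image,
  and products there can be computed on generating sets.\<close>

lemma closure_omult_closure:
  assumes "nonempty_sub X" "nonempty_sub Y"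
  shows "c (set_omult N (c X) (c Y)) = c (set_omult N X Y)"
proof
  show "c (set_omult N (c X) (c Y)) \<subseteq> c (set_omult N X Y)"
    using assms closure_omult closure_le_iff closure_in_carrier closure_closed nonempty_sub_omult
    by metis
  show "c (set_omult N X Y) \<subseteq> c (set_omult N (c X) (c Y))"
    using assms by (intro closure_mono nonempty_sub_omult closure_closed set_omult_mono closure_expansive)
qed

lemma ordered_magma_Q: "ordered_magma Q"
proof
  show "X \<cdot>\<^bsub>Q\<^esub> Y \<in> carrier Q" if "X \<in> carrier Q" "Y \<in> carrier Q" for X Y
    using that by (simp add: closure_in_carrier carrier_iff nonempty_sub_omult closure_closed closure_idem)
  show "X \<cdot>\<^bsub>Q\<^esub> Y \<sqsubseteq>\<^bsub>Q\<^esub> X' \<cdot>\<^bsub>Q\<^esub> Y'"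
    if "X \<in> carrier Q" "X' \<in> carrier Q" "Y \<in> carrier Q" "Y' \<in> carrier Q" "X \<sqsubseteq>\<^bsub>Q\<^esub> X'" "Y \<sqsubseteq>\<^bsub>Q\<^esub> Y'"
    for X X' Y Y'
    using that by (simp add: carrier_iff closure_mono nonempty_sub_omult set_omult_mono)
qed (auto simp: fun_eq_iff)

lemma is_lub_closure_Union:
  assumes "\<X> \<subseteq> carrier Q" "\<X> \<noteq> {}"
  shows "is_lub Q (c (\<Union>\<X>)) \<X>"
proof -
  have U: "nonempty_sub (\<Union>\<X>)"
    using assms carrier_iff by (intro nonempty_sub_Union) blast+
  show ?thesis
    unfolding is_lub_iff[OF assms(1)]
    using closure_in_carrier[OF U] closure_expansive[OF U] closure_le_iff[OF U]
    by (simp add: Union_least) blast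
qed

text \<open>The additive counterpart of \<open>closure_omult_closure\<close>: \<open>c\<close>
  carries unions to suprema of closed sets.\<close>

lemma closure_UN_closure:
  assumes "I \<noteq> {}" "\<And>i. i \<in> I \<Longrightarrow> nonempty_sub (X i)"
  shows "c (\<Union>i\<in>I. c (X i)) = c (\<Union>i\<in>I. X i)"
proof -
  have U: "nonempty_sub (\<Union>i\<in>I. X i)" "nonempty_sub (\<Union>i\<in>I. c (X i))"
    using assms closure_closed by (auto intro!: nonempty_sub_Union)
  have "c (X i) \<subseteq> c (\<Union>i\<in>I. X i)" if "i \<in> I" for i
    using assms U that by (intro closure_mono) auto
  then have "c (\<Union>i\<in>I. c (X i)) \<subseteq> c (\<Union>i\<in>I. X i)"
    using closure_le_iff[OF U(2) closure_in_carrier[OF U(1)]] by blast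
  moreover have "c (\<Union>i\<in>I. X i) \<subseteq> c (\<Union>i\<in>I. c (X i))"
    using assms closure_expansive by (intro closure_mono U) blast
  ultimately show ?thesis
    by blast
qed

text \<open>Distributivity descends from plain sets: pull \<open>c\<close> out of the product,
  distribute over the union there, and reinsert \<open>c\<close> around each term.\<close>

lemma near_prequantale_Q: "near_prequantale Q"
proof (rule near_prequantaleI[OF ordered_magma_Q])
  fix \<X> assume X: "\<X> \<subseteq> carrier Q" "\<X> \<noteq> {}"
  have ns: "nonempty_sub X" if "X \<in> \<X>" for X
    using X that carrier_iff by blast
  have U: "nonempty_sub (\<Union>\<X>)"
    using X ns by (intro nonempty_sub_Union)
  have "is_lub Q (A \<cdot>\<^bsub>Q\<^esub> c (\<Union>\<X>)) ((\<lambda>X. A \<cdot>\<^bsub>Q\<^esub> X) ` \<X>) \<and>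
      is_lub Q (c (\<Union>\<X>) \<cdot>\<^bsub>Q\<^esub> A) ((\<lambda>X. X \<cdot>\<^bsub>Q\<^esub> A) ` \<X>)" if A: "A \<in> carrier Q" for A
  proof -
    have nA: "nonempty_sub A" "c A = A"
      using A carrier_iff by auto
    have "A \<cdot>\<^bsub>Q\<^esub> c (\<Union>\<X>) = c (set_omult N A (\<Union>\<X>))"
      using closure_omult_closure[OF nA(1) U] nA by simp
    also have "\<dots> = c (\<Union>X\<in>\<X>. c (set_omult N A X))"
      unfolding set_omult_UN using X nA ns by (intro closure_UN_closure[symmetric] nonempty_sub_omult)
    finally have l: "A \<cdot>\<^bsub>Q\<^esub> c (\<Union>\<X>) = c (\<Union>((\<lambda>X. A \<cdot>\<^bsub>Q\<^esub> X) ` \<X>))"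
      by simp
    have "c (\<Union>\<X>) \<cdot>\<^bsub>Q\<^esub> A = c (set_omult N (\<Union>\<X>) A)"
      using closure_omult_closure[OF U nA(1)] nA by simp
    also have "\<dots> = c (\<Union>X\<in>\<X>. c (set_omult N X A))"
      unfolding set_omult_UN using X nA ns by (intro closure_UN_closure[symmetric] nonempty_sub_omult)
    finally have r: "c (\<Union>\<X>) \<cdot>\<^bsub>Q\<^esub> A = c (\<Union>((\<lambda>X. X \<cdot>\<^bsub>Q\<^esub> A) ` \<X>))"
      by simp
    show ?thesis
      unfolding l r using X A ordered_magma.omult_closed[OF ordered_magma_Q]
      by (intro conjI is_lub_closure_Union) blast+
  qed
  then show "\<exists>s. is_lub Q s \<X> \<and> (\<forall>a\<in>carrier Q. is_lub Q (a \<cdot>\<^bsub>Q\<^esub> s) ((\<lambda>x. a \<cdot>\<^bsub>Q\<^esub> x) ` \<X>) \<and>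
      is_lub Q (s \<cdot>\<^bsub>Q\<^esub> a) ((\<lambda>x. x \<cdot>\<^bsub>Q\<^esub> a) ` \<X>))"
    using is_lub_closure_Union[OF X] by blast
qed

lemma directed_lub:
  assumes D: "directed_subset Q D" and s: "is_lub Q s D"
  shows "s = \<Union>D"
proof -
  let ?P = "nonempty_powerset N"
  have DQ: "D \<subseteq> carrier Q" "D \<noteq> {}"
    using D by (auto simp: directed_subset_def)
  have DP: "D \<subseteq> carrier ?P"
    using DQ carrier_iff by (auto simp: nonempty_powerset_def nonempty_sub_def)
  have cD: "c ` D = D"
    using DQ carrier_iff by force
  have "directed_subset ?P D"
    using D DP by (simp add: directed_subset_def) (simp add: nonempty_powerset_def)
  then have "is_lub ?P (c (\<Union>D)) D"
    using finitary nonempty_powerset_is_lub[OF DP DQ(2)] cD unfolding finitary_def by metis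
  then have "c (\<Union>D) = \<Union>D"
    using nonempty_powerset_is_lub_iff[OF DP DQ(2)] by simp
  then show ?thesis
    using is_lub_closure_Union[OF DQ] s ordered_magma_Q
    by (metis ordered_magma_def partial_order.least_unique)
qed

section \<open>Compact elements of the nucleus image\<close>

lemma closure_finite_compact:
  assumes F: "nonempty_sub F" "finite F"
  shows "c F \<in> compact_elements Q"
proof -
  have "\<exists>y\<in>D. c F \<sqsubseteq>\<^bsub>Q\<^esub> y" if D: "directed_subset Q D" and s: "is_lub Q s D" "c F \<sqsubseteq>\<^bsub>Q\<^esub> s" for D s
  proof -
    have "F \<subseteq> \<Union>D"
      using closure_expansive[OF F(1)] s directed_lub[OF D s(1)] by auto
    then obtain D' where D': "finite D'" "D' \<subseteq> D" "F \<subseteq> \<Union>D'"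
      using F(2) finite_subset_Union by metis
    then have "\<exists>u\<in>D. \<forall>x\<in>D'. x \<sqsubseteq>\<^bsub>Q\<^esub> u"
      using D unfolding directed_subset_def by blast
    then obtain u where u: "u \<in> D" "\<Union>D' \<subseteq> u"
      by (auto simp: Sup_le_iff)
    then have "F \<subseteq> u"
      using D' by blast
    moreover have "u \<in> carrier Q"
      using D u by (auto simp only: directed_subset_def)
    ultimately have "c F \<subseteq> u"
      using closure_le_iff[OF F(1), of u] by simp
    then show ?thesis
      using u by auto
  qed
  then show ?thesis
    using closure_in_carrier[OF F(1)] by (auto simp: compact_elements_def)
qed

text \<open>Every closed \<open>X\<close> is the directed supremum of the closures of its finite
  nonempty subsets; if \<open>X\<close> is compact, one of these closures already contains
  \<open>X\<close>.\<close>

lemma compact_is_closure_finite: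
  assumes X: "X \<in> compact_elements Q"
  obtains F where "nonempty_sub F" "finite F" "X = c F"
proof -
  have XQ: "X \<in> carrier Q" "nonempty_sub X"
    using X by (auto simp: compact_elements_def carrier_iff)
  define D where "D = c ` {F. F \<subseteq> X \<and> F \<noteq> {} \<and> finite F}"
  have ns: "nonempty_sub F" if "F \<subseteq> X" "F \<noteq> {}" for F
    using that XQ by (auto simp: nonempty_sub_def)
  have DQ: "D \<subseteq> carrier Q"
    using ns closure_in_carrier by (auto simp: D_def)
  obtain x where x: "x \<in> X"
    using XQ by (auto simp: nonempty_sub_def)
  have "directed_subset Q D"
    unfolding directed_subset_def
  proof (intro conjI allI impI; (elim conjE)?)
    show "D \<noteq> {}"
      using x by (auto simp: D_def)
    fix E assume E: "finite E" "E \<subseteq> D"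
    then obtain \<F> where \<F>: "\<F> \<subseteq> {F. F \<subseteq> X \<and> F \<noteq> {} \<and> finite F}" "finite \<F>" "E = c ` \<F>"
      unfolding D_def using finite_subset_image[OF E(1)] by meson
    \<comment> \<open>Inserting \<open>x\<close> keeps \<open>G\<close> nonempty when the family of
      finite sets is empty.\<close>
    define G where "G = insert x (\<Union>\<F>)"
    have G: "G \<subseteq> X" "G \<noteq> {}" "finite G"
      using \<F> x by (auto simp: G_def)
    have "c F \<subseteq> c G" if "F \<in> \<F>" for F
      using that \<F> G ns by (intro closure_mono) (auto simp: G_def)
    then show "\<exists>u\<in>D. \<forall>y\<in>E. y \<sqsubseteq>\<^bsub>Q\<^esub> u"
      using G \<F> by (intro bexI[of _ "c G"]) (auto simp: D_def)
  qed (rule DQ)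
  moreover have "is_lub Q X D"
    unfolding is_lub_iff[OF DQ]
  proof (intro conjI ballI impI XQ)
    show "F \<sqsubseteq>\<^bsub>Q\<^esub> X" if "F \<in> D" for F
      using that closure_le_iff[OF ns XQ(1)] by (auto simp: D_def)
    show "X \<sqsubseteq>\<^bsub>Q\<^esub> U" if U: "U \<in> carrier Q" "\<forall>F\<in>D. F \<sqsubseteq>\<^bsub>Q\<^esub> U" for U
    proof -
      have "y \<in> U" if "y \<in> X" for y
      proof -
        have "c {y} \<in> D"
          using that by (auto simp: D_def)
        then show ?thesis
          using U(2) closure_expansive[OF ns, of "{y}"] that by auto
      qed
      then show ?thesis
        by auto
    qed
  qed
  ultimately obtain Y where "Y \<in> D" "X \<subseteq> Y"
    using X by (force simp: compact_elements_def)
  then obtain F where F: "F \<subseteq> X" "F \<noteq> {}" "finite F" "X \<subseteq> c F"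
    by (auto simp: D_def)
  then have "X = c F"
    using closure_le_iff[OF ns XQ(1)] by blast
  then show thesis
    using that F ns by blast
qed

lemma precoherent_Q: "precoherent Q"
proof -
  interpret Q: ordered_magma Q by (rule ordered_magma_Q)
  show ?thesis
  proof
    fix X assume X: "X \<in> carrier Q"
    then have ns: "nonempty_sub X" "c X = X"
      by (auto simp: carrier_iff)
    have nx: "nonempty_sub {x}" if "x \<in> X" for x
      using that ns by (auto simp: nonempty_sub_def)
    \<comment> \<open>Closures of singletons suffice as compact generators, since \<open>X\<close>
      is the union of its singletons.\<close>
    define \<X> where "\<X> = (\<lambda>x. c {x}) ` X"
    have "\<X> \<noteq> {}"
      using ns by (auto simp: \<X>_def nonempty_sub_def)
    moreover have K: "\<X> \<subseteq> compact_elements Q"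
      using nx closure_finite_compact by (auto simp: \<X>_def)
    ultimately have "is_lub Q (c (\<Union>\<X>)) \<X>"
      by (intro is_lub_closure_Union) (auto simp: compact_elements_def)
    also have "c (\<Union>\<X>) = c (\<Union>x\<in>X. {x})"
      unfolding \<X>_def using ns nx by (intro closure_UN_closure) (auto simp: nonempty_sub_def)
    finally show "\<exists>\<X>. \<X> \<subseteq> compact_elements Q \<and> is_lub Q X \<X>"
      using ns K by auto
  next
    fix X Y assume "X \<in> compact_elements Q" "Y \<in> compact_elements Q"
    then obtain F G where FG: "nonempty_sub F" "finite F" "X = c F" "nonempty_sub G" "finite G" "Y = c G"
      by (metis compact_is_closure_finite)
    then have "X \<cdot>\<^bsub>Q\<^esub> Y = c (set_omult N F G)"
      by (simp add: closure_omult_closure)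
    then show "X \<cdot>\<^bsub>Q\<^esub> Y \<in> compact_elements Q"
      using FG by (simp only:) (intro closure_finite_compact nonempty_sub_omult, auto simp: set_omult_image)
  qed
qed

end

lemma nucleus_image_precoherent_near_prequantale:
  assumes "ordered_magma N" "nucleus (nonempty_powerset N) c" "finitary (nonempty_powerset N) c"
  shows "precoherent (nucleus_image (nonempty_powerset N) c)"
    and "near_prequantale (nucleus_image (nonempty_powerset N) c)"
proof -
  interpret finitary_nucleus N c
    using assms by (simp add: finitary_nucleus_def finitary_nucleus_axioms_def)
  show "precoherent Q" "near_prequantale Q"
    by (rule precoherent_Q near_prequantale_Q)+
qed

section \<open>Ideal completions\<close>

context
  fixes N :: "'a omagma" (structure)
  assumes multiplicative_semilattice: "multiplicative_semilattice N"
begin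

interpretation multiplicative_semilattice N
  by (rule multiplicative_semilattice)

lemma finite_sup_upper: "\<lbrakk>finite T; T \<subseteq> carrier N; x \<in> T\<rbrakk> \<Longrightarrow> x \<sqsubseteq> \<Squnion>T"
  using finite_sup_least by (blast intro: least_Upper_above)

lemma finite_sup_le:
  "\<lbrakk>finite T; T \<subseteq> carrier N; T \<noteq> {}; u \<in> carrier N; \<And>x. x \<in> T \<Longrightarrow> x \<sqsubseteq> u\<rbrakk> \<Longrightarrow> \<Squnion>T \<sqsubseteq> u"
  by (rule is_lub_le[OF finite_sup_least])

lemma finite_sup_mono:
  "\<lbrakk>finite U; U \<subseteq> carrier N; T \<subseteq> U; T \<noteq> {}\<rbrakk> \<Longrightarrow> \<Squnion>T \<sqsubseteq> \<Squnion>U"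
  by (intro finite_sup_le finite_sup_upper finite_sup_closed) (auto dest: finite_subset)

text \<open>An upper bound in \<open>I\<close> of two elements dominates their join, so downward
  closure puts the join in \<open>I\<close>. Conversely, iterated joins bound finite subsets, with
  nonemptiness of \<open>I\<close> covering the empty one. Ideals thus become subsets closed under
  algebraic conditions.\<close>

lemma order_ideals_iff:
  "I \<in> order_ideals N \<longleftrightarrow> I \<subseteq> carrier N \<and> I \<noteq> {} \<and> (\<forall>x\<in>I. \<forall>y\<in>I. x \<squnion> y \<in> I) \<and>
    (\<forall>x\<in>I. \<forall>y\<in>carrier N. y \<sqsubseteq> x \<longrightarrow> y \<in> I)"
proof -
  have *: "(\<forall>F. finite F \<and> F \<subseteq> I \<longrightarrow> (\<exists>u\<in>I. \<forall>x\<in>F. x \<sqsubseteq> u)) \<longleftrightarrow> (\<forall>x\<in>I. \<forall>y\<in>I. x \<squnion> y \<in> I)"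
    if I: "I \<subseteq> carrier N" "I \<noteq> {}" and down: "\<And>x y. \<lbrakk>x \<in> I; y \<in> carrier N; y \<sqsubseteq> x\<rbrakk> \<Longrightarrow> y \<in> I"
  proof (intro iffI ballI allI impI)
    fix x y assume dir: "\<forall>F. finite F \<and> F \<subseteq> I \<longrightarrow> (\<exists>u\<in>I. \<forall>x\<in>F. x \<sqsubseteq> u)" and xy: "x \<in> I" "y \<in> I"
    obtain u where "u \<in> I" "\<forall>z\<in>{x, y}. z \<sqsubseteq> u"
      using dir[rule_format, of "{x, y}"] xy by auto
    moreover from this have "u \<in> carrier N" "x \<in> carrier N" "y \<in> carrier N"
      using I xy by auto
    ultimately show "x \<squnion> y \<in> I"
      by (intro down[OF \<open>u \<in> I\<close>] join_le join_closed) simp_all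
  next
    fix F assume join: "\<forall>x\<in>I. \<forall>y\<in>I. x \<squnion> y \<in> I" and F: "finite F \<and> F \<subseteq> I"
    from F have "finite F" "F \<subseteq> I"
      by auto
    then show "\<exists>u\<in>I. \<forall>x\<in>F. x \<sqsubseteq> u"
    proof (induction F)
      case empty
      then show ?case
        using I by auto
    next
      case (insert x F)
      then obtain u where u: "u \<in> I" "\<forall>z\<in>F. z \<sqsubseteq> u"
        by auto
      have "z \<sqsubseteq> x \<squnion> u" if "z \<in> insert x F" for z
      proof -
        have c: "x \<in> carrier N" "u \<in> carrier N" "z \<in> carrier N"
          using insert.prems u that I by auto
        show ?thesis
          using that u c join_left[of x u] join_right[of x u]
          by (auto intro: le_trans[of z u])
      qed
      then show ?case
        using join u insert.prems by blast
    qed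
  qed
  show ?thesis
  \<comment> \<open>The equivalence \<open>*\<close> is available only for nonempty downward closed
    \<open>I\<close>; for any other \<open>I\<close> both sides fail.\<close>
  proof (cases "I \<subseteq> carrier N \<and> I \<noteq> {} \<and> (\<forall>x\<in>I. \<forall>y\<in>carrier N. y \<sqsubseteq> x \<longrightarrow> y \<in> I)")
    case True
    with * show ?thesis
      by (simp add: order_ideals_def directed_subset_def)
  next
    case False
    then show ?thesis
      unfolding order_ideals_def directed_subset_def mem_Collect_eq by argo
  qed
qed

lemma idealD:
  assumes "I \<in> order_ideals N"
  shows "I \<subseteq> carrier N" "I \<noteq> {}"
    and "\<lbrakk>x \<in> I; y \<in> I\<rbrakk> \<Longrightarrow> x \<squnion> y \<in> I"
    and "\<lbrakk>x \<in> I; y \<in> carrier N; y \<sqsubseteq> x\<rbrakk> \<Longrightarrow> y \<in> I"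
  using assms by (simp_all add: order_ideals_iff)

lemma ideal_finite_sup:
  assumes "I \<in> order_ideals N" "finite T" "T \<noteq> {}" "T \<subseteq> I"
  shows "\<Squnion>T \<in> I"
proof -
  have "\<exists>u\<in>I. \<forall>x\<in>T. x \<sqsubseteq> u"
    using assms by (simp add: order_ideals_def directed_subset_def)
  then obtain u where u: "u \<in> I" "\<forall>x\<in>T. x \<sqsubseteq> u"
    by blast
  have I: "I \<subseteq> carrier N" "T \<subseteq> carrier N"
    using idealD(1)[OF assms(1)] assms(4) by auto
  then have "\<Squnion>T \<sqsubseteq> u" "\<Squnion>T \<in> carrier N"
    using u assms(2,3) by (auto intro!: finite_sup_le)
  then show ?thesis
    by (rule idealD(4)[OF assms(1) u(1), rotated])
qed

lemma ideal_generated_least: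
  assumes "I \<in> order_ideals N" "X \<subseteq> I"
  shows "ideal_generated N X \<subseteq> I"
proof
  fix y assume "y \<in> ideal_generated N X"
  then obtain T where T: "y \<in> carrier N" "finite T" "T \<noteq> {}" "T \<subseteq> X" "y \<sqsubseteq> \<Squnion>T"
    unfolding ideal_generated_def by blast
  then have "\<Squnion>T \<in> I"
    using assms by (intro ideal_finite_sup) auto
  then show "y \<in> I"
    by (rule idealD(4)[OF assms(1) _ T(1,5)])
qed

lemma ideal_generated_expansive:
  assumes "X \<subseteq> carrier N"
  shows "X \<subseteq> ideal_generated N X"
proof
  fix x assume x: "x \<in> X"
  then have "x \<sqsubseteq> \<Squnion>{x}"
    using assms by (intro finite_sup_upper) auto
  then show "x \<in> ideal_generated N X"
    using x assms unfolding ideal_generated_def by blast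
qed

text \<open>If two elements lie below the joins of \<open>T\<close> and of \<open>U\<close>, their
  join lies below the join of \<open>T \<union> U\<close>.\<close>

lemma ideal_generated_ideal:
  assumes X: "X \<subseteq> carrier N" "X \<noteq> {}"
  shows "ideal_generated N X \<in> order_ideals N"
  unfolding order_ideals_iff
proof (intro conjI ballI impI)
  show "ideal_generated N X \<subseteq> carrier N"
    by (auto simp: ideal_generated_def)
  show "ideal_generated N X \<noteq> {}"
    using ideal_generated_expansive[OF X(1)] X(2) by blast
  fix x assume "x \<in> ideal_generated N X"
  then obtain T where T: "x \<in> carrier N" "finite T" "T \<noteq> {}" "T \<subseteq> X" "x \<sqsubseteq> \<Squnion>T"
    unfolding ideal_generated_def by blast
  have Tc: "\<Squnion>T \<in> carrier N"
    using T X by auto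
  show "y \<in> ideal_generated N X" if "y \<in> carrier N" "y \<sqsubseteq> x" for y
    unfolding ideal_generated_def mem_Collect_eq
    using le_trans[OF that(2) T(5) that(1) T(1) Tc] that(1) T by (intro conjI exI[of _ T])
  fix y assume "y \<in> ideal_generated N X"
  then obtain U where U: "y \<in> carrier N" "finite U" "U \<noteq> {}" "U \<subseteq> X" "y \<sqsubseteq> \<Squnion>U"
    unfolding ideal_generated_def by blast
  have Uc: "\<Squnion>U \<in> carrier N" and TUc: "\<Squnion>(T \<union> U) \<in> carrier N"
    using T U X by (simp_all add: subset_trans)
  have TU: "\<Squnion>T \<sqsubseteq> \<Squnion>(T \<union> U)" "\<Squnion>U \<sqsubseteq> \<Squnion>(T \<union> U)"
    using T U X by (auto intro!: finite_sup_mono)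
  have "x \<squnion> y \<sqsubseteq> \<Squnion>(T \<union> U)"
    using le_trans[OF T(5) TU(1) T(1) Tc TUc] le_trans[OF U(5) TU(2) U(1) Uc TUc]
    by (intro join_le T U TUc)
  moreover have "x \<squnion> y \<in> carrier N"
    using T(1) U(1) by simp
  moreover have "finite (T \<union> U)" "T \<union> U \<noteq> {}" "T \<union> U \<subseteq> X"
    using T U by auto
  ultimately show "x \<squnion> y \<in> ideal_generated N X"
    unfolding ideal_generated_def mem_Collect_eq by (intro conjI exI[of _ "T \<union> U"])
qed

lemma ideal_generated_mono: "X \<subseteq> Y \<Longrightarrow> ideal_generated N X \<subseteq> ideal_generated N Y"
  unfolding ideal_generated_def by blast

lemma ideal_generated_idem: "I \<in> order_ideals N \<Longrightarrow> ideal_generated N I = I"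
  using ideal_generated_least[of I I] ideal_generated_expansive[of I] idealD(1)[of I] by blast

text \<open>
  Because residuals of ideals are ideals, the nucleus inequality can be checked one factor at a time
  on generators.
\<close>

lemma ideal_residual:
  assumes I: "I \<in> order_ideals N" and y: "y \<in> carrier N"
  shows "{x \<in> carrier N. x \<cdot> y \<in> I} \<noteq> {} \<Longrightarrow> {x \<in> carrier N. x \<cdot> y \<in> I} \<in> order_ideals N"
    and "{x \<in> carrier N. y \<cdot> x \<in> I} \<noteq> {} \<Longrightarrow> {x \<in> carrier N. y \<cdot> x \<in> I} \<in> order_ideals N"
proof -
  have down: "\<And>u v. \<lbrakk>u \<in> I; v \<in> carrier N; v \<sqsubseteq> u\<rbrakk> \<Longrightarrow> v \<in> I"
    and join: "\<And>u v. \<lbrakk>u \<in> I; v \<in> I\<rbrakk> \<Longrightarrow> u \<squnion> v \<in> I"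
    using idealD[OF I] by auto
  have "v \<cdot> y \<in> I" if "u \<cdot> y \<in> I" "u \<in> carrier N" "v \<in> carrier N" "v \<sqsubseteq> u" for u v
    using that y by (intro down[OF that(1)] omult_closed omult_mono) auto
  moreover have "y \<cdot> v \<in> I" if "y \<cdot> u \<in> I" "u \<in> carrier N" "v \<in> carrier N" "v \<sqsubseteq> u" for u v
    using that y by (intro down[OF that(1)] omult_closed omult_mono) auto
  ultimately show "{x \<in> carrier N. x \<cdot> y \<in> I} \<noteq> {} \<Longrightarrow> {x \<in> carrier N. x \<cdot> y \<in> I} \<in> order_ideals N"
    and "{x \<in> carrier N. y \<cdot> x \<in> I} \<noteq> {} \<Longrightarrow> {x \<in> carrier N. y \<cdot> x \<in> I} \<in> order_ideals N"
    using y join unfolding order_ideals_iff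
    by (simp_all add: omult_join_left omult_join_right) blast+
qed

lemma ideal_generated_omult:
  assumes X: "X \<subseteq> carrier N" "X \<noteq> {}" and Y: "Y \<subseteq> carrier N" "Y \<noteq> {}"
  shows "set_omult N (ideal_generated N X) (ideal_generated N Y) \<subseteq> ideal_generated N (set_omult N X Y)"
    (is "_ \<subseteq> ?I")
proof -
  have XY: "set_omult N X Y \<subseteq> carrier N" "set_omult N X Y \<noteq> {}"
    using X Y omult_closed unfolding set_omult_def by blast+
  have I: "?I \<in> order_ideals N" and XYI: "set_omult N X Y \<subseteq> ?I"
    using ideal_generated_ideal[OF XY] ideal_generated_expansive[OF XY(1)] by auto
  \<comment> \<open>Left factor first: for a generator \<open>y\<close>, the residual contains
    \<open>X\<close>, hence the ideal that \<open>X\<close> generates. Nonemptiness of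
    \<open>X\<close> makes the residual nonempty, as an ideal must be.\<close>
  have 1: "x \<cdot> y \<in> ?I" if "x \<in> ideal_generated N X" "y \<in> Y" for x y
  proof -
    have "X \<subseteq> {x \<in> carrier N. x \<cdot> y \<in> ?I}"
      using X XYI that unfolding set_omult_def by blast
    then show ?thesis
      using ideal_generated_least[OF ideal_residual(1)[OF I, of y]] that X Y by blast
  qed
  \<comment> \<open>Now \<open>x\<close> is an arbitrary element of the generated ideal, and the
    first pass says that its residual contains \<open>Y\<close>.\<close>
  have "x \<cdot> y \<in> ?I" if x: "x \<in> ideal_generated N X" and y: "y \<in> ideal_generated N Y" for x y
  proof -
    have "Y \<subseteq> {y \<in> carrier N. x \<cdot> y \<in> ?I}"
      using 1[OF x] Y by blast
    moreover have "x \<in> carrier N"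
      using x unfolding ideal_generated_def by blast
    ultimately show ?thesis
      using ideal_generated_least[OF ideal_residual(2)[OF I, of x]] y Y by blast
  qed
  then show ?thesis
    unfolding set_omult_def by blast
qed

section \<open>Ideal generation as a finitary nucleus\<close>

lemma ideal_generated_nucleus: "nucleus (nonempty_powerset N) (ideal_generated N)"
proof -
  have "ideal_generated N X \<subseteq> carrier N \<and> ideal_generated N X \<noteq> {}" if "X \<subseteq> carrier N" "X \<noteq> {}" for X
    using idealD(1,2)[OF ideal_generated_ideal[OF that]] by blast
  \<comment> \<open>The predicate \<open>isotone\<close> includes that source and target are
    partially ordered.\<close>
  moreover have "weak_partial_order (nonempty_powerset N)"
    by unfold_locales (auto simp: nonempty_powerset_def)
  ultimately show ?thesis
    using ideal_generated_expansive ideal_generated_mono ideal_generated_omult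
      ideal_generated_idem[OF ideal_generated_ideal]
    by (auto simp: nucleus_def closure_operation_def isotone_def idempotent_def nonempty_powerset_def)
qed

text \<open>Membership in a generated ideal involves only a finite set \<open>T\<close> of
  generators, and a finite subset of a directed union lies in one member.\<close>

lemma ideal_generated_finitary: "finitary (nonempty_powerset N) (ideal_generated N)"
  unfolding finitary_def
proof (intro allI impI; elim conjE)
  let ?P = "nonempty_powerset N"
  fix D s assume D: "directed_subset ?P D" and s: "is_lub ?P s D"
  have DP: "D \<subseteq> carrier ?P" "D \<noteq> {}"
    using D by (auto simp: directed_subset_def)
  have s_eq: "s = \<Union>D"
    using nonempty_powerset_is_lub_iff[OF DP] s by blast
  have cDP: "ideal_generated N ` D \<subseteq> carrier ?P"
    using DP(1) ideal_generated_nucleus by (auto simp: nucleus_def closure_operation_def)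
  have "ideal_generated N (\<Union>D) \<subseteq> \<Union>(ideal_generated N ` D)"
  proof
    fix y assume "y \<in> ideal_generated N (\<Union>D)"
    then obtain T where T: "y \<in> carrier N" "finite T" "T \<noteq> {}" "T \<subseteq> \<Union>D" "y \<sqsubseteq> \<Squnion>T"
      unfolding ideal_generated_def by blast
    then obtain E where E: "finite E" "E \<subseteq> D" "T \<subseteq> \<Union>E"
      using finite_subset_Union by metis
    then have "\<exists>u\<in>D. \<forall>X\<in>E. X \<sqsubseteq>\<^bsub>?P\<^esub> u"
      using D unfolding directed_subset_def by blast
    then obtain u where u: "u \<in> D" "\<Union>E \<subseteq> u"
      by (auto simp: nonempty_powerset_def Sup_le_iff)
    then have "T \<subseteq> u"
      using E(3) by (intro order_trans[of T "\<Union>E" u])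
    then have "y \<in> ideal_generated N u"
      unfolding ideal_generated_def mem_Collect_eq using T by (intro conjI exI[of _ T])
    then show "y \<in> \<Union>(ideal_generated N ` D)"
      using u(1) by (rule UN_I[rotated])
  qed
  moreover have "\<Union>(ideal_generated N ` D) \<subseteq> ideal_generated N (\<Union>D)"
    using ideal_generated_mono by (simp add: SUP_le_iff Union_upper)
  ultimately have "ideal_generated N s = \<Union>(ideal_generated N ` D)"
    using s_eq by blast
  then show "is_lub ?P (ideal_generated N s) (ideal_generated N ` D)"
    using nonempty_powerset_is_lub[OF cDP] DP by simp
qed

lemma ideal_completion_eq_nucleus_image:
  "ideal_completion N = nucleus_image (nonempty_powerset N) (ideal_generated N)"
proof -
  have "order_ideals N = ideal_generated N ` (Pow (carrier N) - {{}})"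
  proof
    show "order_ideals N \<subseteq> ideal_generated N ` (Pow (carrier N) - {{}})"
    proof
      fix I assume I: "I \<in> order_ideals N"
      then have "I = ideal_generated N I" "I \<in> Pow (carrier N) - {{}}"
        using ideal_generated_idem idealD(1,2)[OF I] by auto
      then show "I \<in> ideal_generated N ` (Pow (carrier N) - {{}})"
        by blast
    qed
  qed (use ideal_generated_ideal in auto)
  then show ?thesis
    by (simp add: ideal_completion_def nucleus_image_def nonempty_powerset_def)
qed

end

section \<open>The semilattice of compact elements\<close>

locale precoherent_near_prequantale = precoherent M + near_prequantale M for M :: "'a omagma" (structure)
begin

abbreviation K :: "'a set"
  where "K \<equiv> compact_elements M"

lemma compact_carrier: "x \<in> K \<Longrightarrow> x \<in> carrier M"
  by (simp add: compact_elements_def)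

lemma compactD: "\<lbrakk>x \<in> K; directed_subset M D; is_lub M s D; x \<sqsubseteq> s\<rbrakk> \<Longrightarrow> \<exists>y\<in>D. x \<sqsubseteq> y"
  unfolding compact_elements_def by blast

lemma compact_join:
  assumes "x \<in> K" "y \<in> K" "is_lub M s {x, y}"
  shows "s \<in> K"
proof -
  have xy: "x \<in> carrier M" "y \<in> carrier M" "{x, y} \<subseteq> carrier M"
    using assms compact_carrier by auto
  note s = assms(3)[unfolded is_lub_iff[OF xy(3)]]
  have "\<exists>z\<in>D. s \<sqsubseteq> z" if D: "directed_subset M D" and t: "is_lub M t D" "s \<sqsubseteq> t" for D t
  proof -
    have "t \<in> carrier M"
      using t by auto
    then have "x \<sqsubseteq> t" "y \<sqsubseteq> t"
      using s t xy le_trans by blast+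
    then obtain u v where uv: "u \<in> D" "x \<sqsubseteq> u" "v \<in> D" "y \<sqsubseteq> v"
      using compactD assms D t by metis
    have DM: "D \<subseteq> carrier M"
      using D by (simp add: directed_subset_def)
    obtain w where w: "w \<in> D" "\<forall>z\<in>{u, v}. z \<sqsubseteq> w"
      using D uv unfolding directed_subset_def by (metis empty_subsetI finite.emptyI finite_insert insert_subset)
    then have "x \<sqsubseteq> w" "y \<sqsubseteq> w"
      using uv xy DM by (auto intro: le_trans)
    then show ?thesis
      using s w DM by blast
  qed
  then show ?thesis
    using s unfolding compact_elements_def by blast
qed

lemma compact_join_exists:
  assumes "x \<in> K" "y \<in> K"
  shows "\<exists>s\<in>K. is_lub M s {x, y}"
  using nonempty_sup_exists[of "{x, y}"] compact_join[OF assms] assms compact_carrier by auto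

abbreviation KM :: "'a omagma"
  where "KM \<equiv> compact_omagma M"

lemma KM_simps [simp]:
  "carrier KM = K" "(.=\<^bsub>KM\<^esub>) = (.=)" "x \<sqsubseteq>\<^bsub>KM\<^esub> y \<longleftrightarrow> x \<sqsubseteq> y" "x \<cdot>\<^bsub>KM\<^esub> y = x \<cdot> y"
  by (simp_all add: compact_omagma_def)

lemma is_lub_KM:
  assumes "A \<subseteq> K" "s \<in> K" "is_lub M s A"
  shows "is_lub KM s A"
proof -
  have "A \<subseteq> carrier M" "A \<subseteq> carrier KM"
    using assms compact_carrier by auto
  then show ?thesis
    using assms compact_carrier by (simp add: is_lub_iff)
qed

lemma partial_order_KM: "partial_order KM"
proof -
  have "weak_partial_order KM"
    unfolding compact_omagma_def using compact_carrier
    by (intro weak_partial_order_subset weak_partial_order_axioms) auto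
  then show ?thesis
    using eq_is_equal by (simp add: partial_order_def partial_order_axioms_def)
qed

text \<open>A supremum in \<open>KM\<close> competes with fewer upper bounds than one in
  \<open>M\<close>. The two agree here because the supremum in \<open>M\<close> is itself compact,
  so uniqueness identifies it with the join of \<open>KM\<close>.\<close>

lemma join_KM:
  assumes "x \<in> K" "y \<in> K"
  shows "x \<squnion>\<^bsub>KM\<^esub> y \<in> K" "is_lub M (x \<squnion>\<^bsub>KM\<^esub> y) {x, y}"
proof -
  obtain s where s: "s \<in> K" "is_lub M s {x, y}"
    using compact_join_exists[OF assms] by blast
  then have "x \<squnion>\<^bsub>KM\<^esub> y = s"
    using partial_order.sup_equality[OF partial_order_KM is_lub_KM] assms by (simp add: join_def)
  then show "x \<squnion>\<^bsub>KM\<^esub> y \<in> K" "is_lub M (x \<squnion>\<^bsub>KM\<^esub> y) {x, y}"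
    using s by auto
qed

lemma multiplicative_semilattice_KM: "multiplicative_semilattice KM"
proof -
  interpret KM: partial_order KM by (rule partial_order_KM)
  show ?thesis
  proof
    show "x \<cdot>\<^bsub>KM\<^esub> y \<in> carrier KM" if "x \<in> carrier KM" "y \<in> carrier KM" for x y
      using that compacts_omult_closed by simp
    show "x \<cdot>\<^bsub>KM\<^esub> y \<sqsubseteq>\<^bsub>KM\<^esub> x' \<cdot>\<^bsub>KM\<^esub> y'"
      if "x \<in> carrier KM" "x' \<in> carrier KM" "y \<in> carrier KM" "y' \<in> carrier KM"
        "x \<sqsubseteq>\<^bsub>KM\<^esub> x'" "y \<sqsubseteq>\<^bsub>KM\<^esub> y'" for x x' y y'
      using that compact_carrier omult_mono by simp
    show "\<exists>s. is_lub KM s {x, y}" if "x \<in> carrier KM" "y \<in> carrier KM" for x y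
      using that compact_join_exists[of x y] is_lub_KM[of "{x, y}"] by auto
    fix a x y assume "a \<in> carrier KM" "x \<in> carrier KM" "y \<in> carrier KM"
    then have k: "a \<in> K" "x \<in> K" "y \<in> K"
      by auto
    then have c: "a \<in> carrier M" "x \<in> carrier M" "y \<in> carrier M"
      using compact_carrier by auto
    note j = join_KM(2)[OF k(2,3)]
    \<comment> \<open>Distributivity over the pair makes this element the supremum in
      \<open>M\<close> of the two products; by \<open>join_KM\<close> their join in
      \<open>KM\<close> is that same supremum.\<close>
    have "is_lub M (a \<cdot> (x \<squnion>\<^bsub>KM\<^esub> y)) {a \<cdot> x, a \<cdot> y}"
      using is_lub_omult_left[OF c(1) _ _ j] c by simp
    then show "a \<cdot>\<^bsub>KM\<^esub> (x \<squnion>\<^bsub>KM\<^esub> y) = a \<cdot>\<^bsub>KM\<^esub> x \<squnion>\<^bsub>KM\<^esub> a \<cdot>\<^bsub>KM\<^esub> y"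
      using join_KM(2)[of "a \<cdot> x" "a \<cdot> y"] k compacts_omult_closed least_unique by simp
    have "is_lub M ((x \<squnion>\<^bsub>KM\<^esub> y) \<cdot> a) {x \<cdot> a, y \<cdot> a}"
      using is_lub_omult_right[OF c(1) _ _ j] c by simp
    then show "(x \<squnion>\<^bsub>KM\<^esub> y) \<cdot>\<^bsub>KM\<^esub> a = x \<cdot>\<^bsub>KM\<^esub> a \<squnion>\<^bsub>KM\<^esub> y \<cdot>\<^bsub>KM\<^esub> a"
      using join_KM(2)[of "x \<cdot> a" "y \<cdot> a"] k compacts_omult_closed least_unique by simp
  qed
qed

section \<open>The isomorphism between \<open>M\<close> and the ideals of its compact
  elements\<close>

definition below :: "'a \<Rightarrow> 'a set"
  where "below x = {k \<in> K. k \<sqsubseteq> x}"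

lemma below_sub: "below x \<subseteq> carrier M"
  using compact_carrier by (auto simp: below_def)

text \<open>Any set of compact elements with supremum \<open>x\<close> is contained in
  \<open>below x\<close>, so passing to the largest such set changes no supremum.\<close>

lemma is_lub_below:
  assumes "x \<in> carrier M"
  shows "is_lub M x (below x)"
proof -
  obtain X where X: "X \<subseteq> K" "is_lub M x X"
    using sup_of_compacts[OF assms] by blast
  then have XM: "X \<subseteq> carrier M"
    using compact_carrier by blast
  have "X \<subseteq> below x"
    using X XM by (auto simp: below_def is_lub_iff)
  then have "x \<sqsubseteq> u" if "u \<in> carrier M" "\<forall>k\<in>below x. k \<sqsubseteq> u" for u
    using that by (intro is_lub_le[OF X(2)]) auto
  then show ?thesis
    unfolding is_lub_iff[OF below_sub] using assms by (simp add: below_def)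
qed

lemma below_nonempty:
  assumes x: "x \<in> carrier M"
  shows "below x \<noteq> {}"
proof
  \<comment> \<open>\<open>x\<close> could only be the supremum of the empty set, but a least element is compact because directed
    sets are nonempty.\<close>
  assume "below x = {}"
  then have "\<forall>u\<in>carrier M. x \<sqsubseteq> u"
    using is_lub_le[OF is_lub_below[OF x]] by simp
  then have "x \<in> K"
    using x by (auto simp: compact_elements_def directed_subset_def subset_iff)
  with \<open>below x = {}\<close> x show False
    by (auto simp: below_def)
qed

lemma below_ideal:
  assumes x: "x \<in> carrier M"
  shows "below x \<in> order_ideals KM"
proof -
  have "k \<squnion>\<^bsub>KM\<^esub> l \<in> below x" if "k \<in> below x" "l \<in> below x" for k l
    using that join_KM[of k l] x compact_carrier
    by (auto simp: below_def is_lub_iff)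
  then show ?thesis
    unfolding order_ideals_iff[OF multiplicative_semilattice_KM]
    using below_nonempty[OF x] x compact_carrier by (auto simp: below_def intro: le_trans)
qed

lemma below_le_iff:
  assumes "x \<in> carrier M" "y \<in> carrier M"
  shows "below x \<subseteq> below y \<longleftrightarrow> x \<sqsubseteq> y"
proof
  assume "below x \<subseteq> below y"
  then show "x \<sqsubseteq> y"
    by (intro is_lub_le[OF is_lub_below[OF assms(1)] assms(2)]) (auto simp: below_def)
next
  assume "x \<sqsubseteq> y"
  then show "below x \<subseteq> below y"
    using assms compact_carrier by (auto simp: below_def intro: le_trans)
qed

text \<open>Surjectivity: take \<open>x\<close> to be the supremum of \<open>I\<close> in
  \<open>M\<close>. A compact element below \<open>x\<close> is below a member of the directed set
  \<open>I\<close>, hence lies in \<open>I\<close> by downward closure.\<close>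

lemma ideal_is_below:
  assumes I: "I \<in> order_ideals KM"
  shows "\<exists>x\<in>carrier M. I = below x"
proof -
  have IK: "I \<subseteq> K" and dir: "directed_subset M I" and down: "\<And>k l. \<lbrakk>k \<in> I; l \<in> K; l \<sqsubseteq> k\<rbrakk> \<Longrightarrow> l \<in> I"
    using I compact_carrier by (auto simp: order_ideals_def directed_subset_def)
  have IM: "I \<subseteq> carrier M" "I \<noteq> {}"
    using dir by (auto simp: directed_subset_def)
  obtain x where x: "is_lub M x I"
    using nonempty_sup_exists[OF IM] by blast
  have "I = below x"
  proof
    show "I \<subseteq> below x"
      using x IK unfolding is_lub_iff[OF IM(1)] below_def by blast
    show "below x \<subseteq> I"
      using compactD[OF _ dir x] down by (auto simp: below_def)
  qed
  then show ?thesis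
    using x by auto
qed

text \<open>Distribute twice: a bound \<open>u\<close> of all products bounds
  \<open>x' \<cdot> y\<close> for each fixed \<open>x'\<close> in \<open>X\<close>, and therefore
  bounds \<open>x \<cdot> y\<close>.\<close>

lemma is_lub_omult:
  assumes X: "X \<subseteq> carrier M" "X \<noteq> {}" "is_lub M x X" and Y: "Y \<subseteq> carrier M" "Y \<noteq> {}" "is_lub M y Y"
  shows "is_lub M (x \<cdot> y) (set_omult M X Y)"
proof -
  have xy: "x \<in> carrier M" "y \<in> carrier M"
    using X Y by auto
  have XY: "set_omult M X Y \<subseteq> carrier M"
    using X Y omult_closed unfolding set_omult_def by blast
  have "x \<cdot> y \<sqsubseteq> u" if u: "u \<in> carrier M" "\<forall>z\<in>set_omult M X Y. z \<sqsubseteq> u" for u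
  proof -
    have "x' \<cdot> y \<sqsubseteq> u" if "x' \<in> X" for x'
    proof (rule is_lub_le[OF is_lub_omult_left[OF _ Y] u(1)])
      show "x' \<in> carrier M"
        using that X by auto
      show "z \<sqsubseteq> u" if "z \<in> (\<lambda>y. x' \<cdot> y) ` Y" for z
        using that \<open>x' \<in> X\<close> u(2) unfolding set_omult_def by blast
    qed
    then show ?thesis
      by (intro is_lub_le[OF is_lub_omult_right[OF xy(2) X] u(1)]) auto
  qed
  moreover have "z \<sqsubseteq> x \<cdot> y" if z: "z \<in> set_omult M X Y" for z
  proof -
    obtain a b where ab: "z = a \<cdot> b" "a \<in> X" "b \<in> Y"
      using z unfolding set_omult_def by blast
    then have "a \<sqsubseteq> x" "b \<sqsubseteq> y"
      using least_Upper_above[OF X(3)] least_Upper_above[OF Y(3)] X Y by auto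
    then show ?thesis
      using ab xy X Y by (auto intro!: omult_mono)
  qed
  ultimately show ?thesis
    unfolding is_lub_iff[OF XY] using omult_closed xy by blast
qed

text \<open>Finitely many products have finitely many left and right factors; bound these separately
  and multiply the bounds.\<close>

lemma directed_omult:
  assumes X: "directed_subset M X" and Y: "directed_subset M Y"
  shows "directed_subset M (set_omult M X Y)"
  unfolding directed_subset_def
proof (intro conjI allI impI; (elim conjE)?)
  have XM: "X \<subseteq> carrier M" and YM: "Y \<subseteq> carrier M"
    using X Y by (auto simp: directed_subset_def)
  then show "set_omult M X Y \<subseteq> carrier M"
    using omult_closed unfolding set_omult_def by blast
  show "set_omult M X Y \<noteq> {}"
    using X Y by (auto simp: set_omult_def directed_subset_def)
  fix F assume F: "finite F" "F \<subseteq> set_omult M X Y"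
  then obtain G where G: "finite G" "G \<subseteq> X \<times> Y" "F = (\<lambda>(x, y). x \<cdot> y) ` G"
    unfolding set_omult_image by (metis finite_subset_image)
  have "finite (fst ` G)" "fst ` G \<subseteq> X" "finite (snd ` G)" "snd ` G \<subseteq> Y"
    using G by auto
  then obtain u v where u: "u \<in> X" "\<forall>x\<in>fst ` G. x \<sqsubseteq> u" and v: "v \<in> Y" "\<forall>y\<in>snd ` G. y \<sqsubseteq> v"
    using X Y unfolding directed_subset_def by metis
  have "x \<cdot> y \<sqsubseteq> u \<cdot> v" if "(x, y) \<in> G" for x y
    using that u v G XM YM by (intro omult_mono) force+
  then show "\<exists>w\<in>set_omult M X Y. \<forall>z\<in>F. z \<sqsubseteq> w"
    using u v G unfolding set_omult_image by (intro bexI[of _ "u \<cdot> v"]) auto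
qed

text \<open>The inclusion from left to right is the substantial one. By \<open>is_lub_omult\<close>
  and \<open>directed_omult\<close>, \<open>x \<cdot> y\<close> is a directed supremum of products
  of compact elements, so a compact element below it is below a single such product and hence in the
  ideal they generate.\<close>

lemma below_omult:
  assumes x: "x \<in> carrier M" and y: "y \<in> carrier M"
  shows "below (x \<cdot> y) = ideal_generated KM (set_omult KM (below x) (below y))"
proof
  let ?P = "set_omult M (below x) (below y)"
  have P: "set_omult KM (below x) (below y) = ?P"
    by (simp add: set_omult_def)
  have xyM: "x \<cdot> y \<in> carrier M"
    using x y omult_closed by blast
  have dir: "directed_subset M (below z)" if "z \<in> carrier M" for z
    using below_ideal[OF that] compact_carrier by (auto simp: order_ideals_def directed_subset_def)
  have PK: "?P \<subseteq> K"
    using compacts_omult_closed by (auto simp: set_omult_def below_def)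
  have Psub: "?P \<subseteq> below (x \<cdot> y)"
    using PK x y compact_carrier by (auto simp: set_omult_def below_def intro!: omult_mono)
  then show "ideal_generated KM (set_omult KM (below x) (below y)) \<subseteq> below (x \<cdot> y)"
    unfolding P using ideal_generated_least[OF multiplicative_semilattice_KM below_ideal[OF xyM]] by blast
  have ex: "\<exists>p\<in>?P. k \<sqsubseteq> p" if k: "k \<in> below (x \<cdot> y)" for k
  proof (rule compactD)
    show "directed_subset M ?P"
      by (intro directed_omult dir x y)
    show "is_lub M (x \<cdot> y) ?P"
      by (intro is_lub_omult below_sub below_nonempty is_lub_below x y)
  qed (use k in \<open>auto simp: below_def\<close>)
  have "?P \<noteq> {}"
    using ex below_nonempty[OF xyM] by blast
  then have "ideal_generated KM ?P \<in> order_ideals KM" and "?P \<subseteq> ideal_generated KM ?P"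
    using PK ideal_generated_ideal[OF multiplicative_semilattice_KM] ideal_generated_expansive[OF multiplicative_semilattice_KM] by simp_all
  then show "below (x \<cdot> y) \<subseteq> ideal_generated KM (set_omult KM (below x) (below y))"
    unfolding P order_ideals_iff[OF multiplicative_semilattice_KM] using ex by (auto simp: below_def) blast
qed

lemma isomorphic_ideal_completion: "omagma_isomorphic M (ideal_completion KM)"
  unfolding omagma_isomorphic_def
proof (intro exI[of _ below] conjI ballI)
  have carr: "carrier (ideal_completion KM) = order_ideals KM"
    by (simp add: ideal_completion_def)
  have "inj_on below (carrier M)"
    using below_le_iff by (intro inj_onI le_antisym) blast+
  moreover have "below ` carrier M = order_ideals KM"
    using below_ideal ideal_is_below by blast
  ultimately show "bij_betw below (carrier M) (carrier (ideal_completion KM))"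
    by (simp add: bij_betw_def carr)
  have "weak_partial_order (ideal_completion KM)"
    by unfold_locales (auto simp: ideal_completion_def)
  then show "order_emb M (ideal_completion KM) below"
    using below_le_iff weak_partial_order_axioms by (simp add: order_emb_def ideal_completion_def)
  show "below (x \<cdot> y) = below x \<cdot>\<^bsub>ideal_completion KM\<^esub> below y"
    if "x \<in> carrier M" "y \<in> carrier M" for x y
    using below_omult[OF that] by (simp add: ideal_completion_def)
qed

lemma compacts_sub_multiplicative_semilattice_KM: "compacts_sub_multiplicative_semilattice M"
  unfolding compacts_sub_multiplicative_semilattice_def
  using compacts_omult_closed compact_join_exists multiplicative_semilattice_KM by blast

end

section \<open>The implications between the four conditions\<close>

lemma isomorphic_nucleus_image_imp:
  assumes "ordered_magma M" "multiplicative_semilattice N"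
    "nucleus (nonempty_powerset N) c" "finitary (nonempty_powerset N) c"
    "omagma_isomorphic M (nucleus_image (nonempty_powerset N) c)"
  shows "precoherent M \<and> near_prequantale M"
  using omagma_isomorphic_transport nucleus_image_precoherent_near_prequantale assms
    multiplicative_semilattice.axioms(1) by blast

lemma isomorphic_ideal_completion_imp:
  assumes "ordered_magma M" "multiplicative_semilattice N" "omagma_isomorphic M (ideal_completion N)"
  shows "precoherent M \<and> near_prequantale M"
  using isomorphic_nucleus_image_imp assms
    ideal_generated_nucleus ideal_generated_finitary
    ideal_completion_eq_nucleus_image by metis

theorem corollary6p16:
  fixes M :: "'a omagma"
  assumes "ordered_magma M"
  shows
    "(precoherent M \<and> near_prequantale M \<longleftrightarrow>
       (\<exists>N :: 'a omagma. multiplicative_semilattice N \<and>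
          omagma_isomorphic M (ideal_completion N)))
     \<and>
     (precoherent M \<and> near_prequantale M \<longleftrightarrow>
       compacts_sub_multiplicative_semilattice M \<and>
       omagma_isomorphic M (ideal_completion (compact_omagma M)))
     \<and>
     (precoherent M \<and> near_prequantale M \<longleftrightarrow>
       (\<exists>(N :: 'a omagma) c. multiplicative_semilattice N \<and>
          nucleus (nonempty_powerset N) c \<and> finitary (nonempty_powerset N) c \<and>
          omagma_isomorphic M (nucleus_image (nonempty_powerset N) c)))
     \<and>
     \<comment> \<open>In (2) and (4) the semilattice may live on any type, not only on that of \<open>M\<close>.\<close>
     (\<forall>N :: 'b omagma. multiplicative_semilattice N \<and>
          omagma_isomorphic M (ideal_completion N) \<longrightarrow>
        precoherent M \<and> near_prequantale M)
     \<and>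
     (\<forall>(N :: 'b omagma) c. multiplicative_semilattice N \<and>
          nucleus (nonempty_powerset N) c \<and> finitary (nonempty_powerset N) c \<and>
          omagma_isomorphic M (nucleus_image (nonempty_powerset N) c) \<longrightarrow>
        precoherent M \<and> near_prequantale M)"
proof -
  have 13: "compacts_sub_multiplicative_semilattice M \<and>
      omagma_isomorphic M (ideal_completion (compact_omagma M))"
    if "precoherent M \<and> near_prequantale M"
  proof -
    interpret precoherent_near_prequantale M
      using that by (simp add: precoherent_near_prequantale_def)
    show ?thesis
      using compacts_sub_multiplicative_semilattice_KM isomorphic_ideal_completion by blast
  qed
  \<comment> \<open>This makes \<open>compact_omagma M\<close> the witness for (2), and through
    \<open>24\<close> also for (4), so the witness lives on the type of \<open>M\<close>.\<close>
  have 32: "multiplicative_semilattice (compact_omagma M)"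
    if "compacts_sub_multiplicative_semilattice M"
    using that by (simp add: compacts_sub_multiplicative_semilattice_def)
  have 24: "nucleus (nonempty_powerset N) (ideal_generated N) \<and>
      finitary (nonempty_powerset N) (ideal_generated N) \<and>
      omagma_isomorphic M (nucleus_image (nonempty_powerset N) (ideal_generated N))"
    if "multiplicative_semilattice N" "omagma_isomorphic M (ideal_completion N)" for N :: "'a omagma"
    using that ideal_generated_nucleus
      ideal_generated_finitary
      ideal_completion_eq_nucleus_image by metis
  note 21 = isomorphic_ideal_completion_imp[OF assms]
  note 41 = isomorphic_nucleus_image_imp[OF assms]
  show ?thesis
    by (intro conjI iffI allI impI) (use 13 32 24 21 41 in blast)+
qed

end
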